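(* Let $d\ge 1$ and $p\in[1,\infty]$, let $\lambda=\lambda(n)>0$ be a sequence in the connectivity regime for $(d,p)$, and let $G=G_p^d(\lambda(n),n)$ be the unit ball random geometric graph. Let $h=h(n)\ge 0$ be a sequence satisfying $$\lim_{n\to\infty} h(n)^{(d+1)/2}\,n=\infty.$$ Then, almost always, $$\operatorname{diam}(G)\ \ge\ \frac{1-h}{\lambda}\,\operatorname{diam}_p(\mathbf{B})\ =\ \begin{cases}2(1-h)\,d^{1/p-1/2}/\lambda & \text{if } 1\le p\le 2,\\ 2(1-h)/\lambda & \text{if } 2\le p\le\infty.\end{cases}$$
   Context: $\mathbf{B}=\{x\in\mathbb{R}^d:\|x\|_2\le 1\}$ is the Euclidean unit ball; $\|\cdot\|_p$ is the $\ell_p$-norm on $\mathbb{R}^d$ ($\max$-norm for $p=\infty$; $1/p=0$ for $p=\infty$). $\operatorname{diam}_p(X)=\sup\{\|x-y\|_p : x,y\in X\}$. The unit ball random geometric graph $G_p^d(\lambda,n)$ has as vertex set $V_n$ a set of $n$ points distributed independently and uniformly (with respect to Lebesgue measure) in $\mathbf{B}$; two vertices $x,y$ are adjacent if and only if $\|x-y\|_p\le\lambda$. The graph distance $d_G(x,y)$ is the length (number of edges) of a shortest path from $x$ to $y$, or $\infty$ if there is none, and $\operatorname{diam}(G)=\max\{d_G(x,y):x,y\in V_n\}$. A property holds almost always if its probability tends to $1$ as $n\to\infty$. Let $\alpha=\alpha_p^d=\operatorname{vol}\{x\in\mathbb{R}^d:\|x\|_p\le 1\}/\operatorname{vol}(\mathbf{B})$.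 A sequence $\lambda=\lambda(n)$ is in the connectivity regime for $(d,p)$ if at least one of the following holds: (i) $d\ge 2$, $p\in(1,\infty]$, and $\lambda(n)\ge\left(\frac{1}{\alpha n}\left(\frac{2(d-1)}{d}\ln n+\frac{2}{d}\ln\ln n+\gamma(n)\right)\right)^{1/d}$ for some nonnegative sequence $\gamma(n)\to\infty$; (ii) $d\ge 2$, $p\in[1,\infty]$, and $\lambda(n)=(c\ln n/n)^{1/d}$ for some constant $c>2(d-1)/(d\alpha)$; (iii) $d=1$, $p\in[1,\infty]$, and $\lambda(n)=2(\ln n+\gamma(n))/n$ with $\gamma(n)\to\infty$. (Inequalities involving $\ln\ln n$ are for all sufficiently large $n$.) *)

theory Defs
  imports "HOL-Probability.Probability"
begin

definition lp_norm :: "ereal \<Rightarrow> real ^ 'd::finite \<Rightarrow> real" where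
  "lp_norm p x =
     (if p = \<infinity> then Max (range (\<lambda>i. \<bar>x $ i\<bar>))
      else (\<Sum>i\<in>UNIV. \<bar>x $ i\<bar> powr real_of_ereal p) powr (1 / real_of_ereal p))"

definition lp_diam :: "ereal \<Rightarrow> (real ^ 'd::finite) set \<Rightarrow> real" where
  "lp_diam p S = Sup {lp_norm p (x - y) | x y. x \<in> S \<and> y \<in> S}"

definition is_path :: "'a set \<Rightarrow> ('a \<Rightarrow> 'a \<Rightarrow> bool) \<Rightarrow> 'a \<Rightarrow> 'a \<Rightarrow> 'a list \<Rightarrow> bool" where
  "is_path V adj x y xs \<longleftrightarrow>
     xs \<noteq> [] \<and> hd xs = x \<and> last xs = y \<and> set xs \<subseteq> V \<and> distinct xs \<and> successively adj xs"

(* The infimum of the empty set in enat is infinity: disconnected vertices are at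
   distance infinity. *)
definition graph_dist :: "'a set \<Rightarrow> ('a \<Rightarrow> 'a \<Rightarrow> bool) \<Rightarrow> 'a \<Rightarrow> 'a \<Rightarrow> enat" where
  "graph_dist V adj x y = (INF xs\<in>{xs. is_path V adj x y xs}. enat (length xs - 1))"

(* Only meaningful for a finite nonempty vertex set. *)
definition graph_diam :: "'a set \<Rightarrow> ('a \<Rightarrow> 'a \<Rightarrow> bool) \<Rightarrow> enat" where
  "graph_diam V adj = Max {graph_dist V adj x y | x y. x \<in> V \<and> y \<in> V}"

definition geom_adj :: "ereal \<Rightarrow> real \<Rightarrow> real ^ 'd::finite \<Rightarrow> real ^ 'd \<Rightarrow> bool" where
  "geom_adj p r x y \<longleftrightarrow> x \<noteq> y \<and> lp_norm p (x - y) \<le> r"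

(* The joint law of n independent uniform points of the unit ball. The vertex set belonging
   to an outcome X is the image of {..<n} under X; almost surely it has exactly n elements. *)
definition ball_points :: "nat \<Rightarrow> (nat \<Rightarrow> real ^ 'd::finite) measure" where
  "ball_points n = (\<Pi>\<^sub>M i\<in>{..<n}. uniform_measure lborel (cball 0 1))"

definition rgg_diam :: "ereal \<Rightarrow> real \<Rightarrow> nat \<Rightarrow> (nat \<Rightarrow> real ^ 'd::finite) \<Rightarrow> enat" where
  "rgg_diam p r n X = graph_diam (X ` {..<n}) (geom_adj p r)"

definition almost_always :: "(nat \<Rightarrow> 'a measure) \<Rightarrow> (nat \<Rightarrow> 'a \<Rightarrow> bool) \<Rightarrow> bool" where
  "almost_always M P \<longleftrightarrow> (\<lambda>n. measure (M n) {\<omega> \<in> space (M n). P n \<omega>}) \<longlonglongrightarrow> 1"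

definition vol_ratio :: "'d::finite itself \<Rightarrow> ereal \<Rightarrow> real" where
  "vol_ratio _ p =
     measure lborel {x :: real ^ 'd. lp_norm p x \<le> 1} / measure lborel (cball 0 1 :: (real ^ 'd) set)"

(* All conditions on r are imposed for large n only. In the second case, demanding the
   equation at n = 1 would force r 1 = 0 and so contradict positivity of r. *)
definition connectivity_regime :: "'d::finite itself \<Rightarrow> ereal \<Rightarrow> (nat \<Rightarrow> real) \<Rightarrow> bool" where
  "connectivity_regime T p r \<longleftrightarrow>
     (let d = real CARD('d); \<alpha> = vol_ratio T p in
       (CARD('d) \<ge> 2 \<and> 1 < p \<and>
         (\<exists>\<gamma>. (\<forall>n. \<gamma> n \<ge> 0) \<and> filterlim \<gamma> at_top sequentially \<and>
           (\<forall>\<^sub>F n in sequentially.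
             r n \<ge> (1 / (\<alpha> * real n) *
                    (2 * (d - 1) / d * ln (real n) + 2 / d * ln (ln (real n)) + \<gamma> n)) powr (1 / d)))) \<or>
       (CARD('d) \<ge> 2 \<and> 1 \<le> p \<and>
         (\<exists>c. c > 2 * (d - 1) / (d * \<alpha>) \<and>
           (\<forall>\<^sub>F n in sequentially. r n = (c * ln (real n) / real n) powr (1 / d)))) \<or>
       (CARD('d) = 1 \<and> 1 \<le> p \<and>
         (\<exists>\<gamma>. filterlim \<gamma> at_top sequentially \<and>
           (\<forall>\<^sub>F n in sequentially. r n = 2 * (ln (real n) + \<gamma> n) / real n))))"

end

theory Submission imports Defs begin

text \<open>
  The \<open>p\<close>-norm has an extremal direction on the Euclidean ball: with
  \<open>K = lp_radius d p\<close>, which is half of the \<open>p\<close>-diameter of the ball, there is a Euclidean unit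
  vector \<open>u\<close> such that \<open>K * (z \<bullet> u) \<le> lp_norm p z \<le> K * norm z\<close> for every \<open>z\<close>
  (lemma \<open>lp_norm_extremal_direction\<close>). For \<open>p \<ge> 2\<close> a coordinate vector is extremal, for \<open>p \<le> 2\<close> the
  normalised diagonal is. By the left inequality an edge of the random geometric graph changes the
  coordinate in direction \<open>u\<close> by at most \<open>r / K\<close>. Hence two vertices whose \<open>u\<close>-coordinates
  differ by at least \<open>2 * (1 - h)\<close> are at graph distance at least \<open>2 * K * (1 - h) / r\<close>, which is the claimed
  bound (lemmas \<open>path_displacement\<close>, \<open>rgg_diam_ge\<close>).

  Such a pair exists as soon as each of the two caps of height \<open>h\<close> around \<open>u\<close> and \<open>- u\<close>
  contains a vertex. A cap of height \<open>h\<close> has thickness of order \<open>h\<close> along its axis and width of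
  order \<open>sqrt h\<close> in each of the \<open>d - 1\<close> orthogonal directions, so its volume is at least a constant
  times \<open>h powr ((d + 1) / 2)\<close> (lemma \<open>cap_volume_ge\<close>). It is missed by all \<open>n\<close> independent points with
  probability at most \<open>exp (- c * h powr ((d + 1) / 2) * n)\<close> (lemma \<open>prob_no_ball_point_in\<close>), and
  this tends to \<open>0\<close> by the growth condition on \<open>h\<close>.
\<close>

section \<open>Comparison of the p-norm with the Euclidean norm\<close>

text \<open>
  The power mean inequality: Jensen's inequality for the convex function \<open>\<lambda>x. x powr s\<close>. Jensen
  is applied on the support of \<open>w\<close>, where convexity on the open half-line suffices; enlarging
  the cardinality afterwards only weakens the bound.
\<close>

lemma powr_sum_le:
  fixes w :: "'i \<Rightarrow> real"
  assumes "finite S" "1 \<le> s" and nonneg: "\<And>i. i \<in> S \<Longrightarrow> 0 \<le> w i"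
  shows "(\<Sum>i\<in>S. w i) powr s \<le> real (card S) powr (s - 1) * (\<Sum>i\<in>S. w i powr s)"
proof -
  define T where "T = {i\<in>S. w i > 0}"
  have fT: "finite T" and TS: "T \<subseteq> S"
    using assms(1) by (auto simp: T_def)
  have w: "(\<Sum>i\<in>S. w i) = (\<Sum>i\<in>T. w i)"
    using nonneg by (intro sum.mono_neutral_right assms(1) TS) (fastforce simp: T_def)
  have ws: "(\<Sum>i\<in>S. w i powr s) = (\<Sum>i\<in>T. w i powr s)"
    using nonneg by (intro sum.mono_neutral_right assms(1) TS) (fastforce simp: T_def)
  show ?thesis
  proof (cases "T = {}")
    case True
    then show ?thesis by (simp add: w ws)
  next
    case False
    define m where "m = real (card T)"
    have m: "m > 0" using False fT by (simp add: m_def card_gt_0_iff)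
    have "(\<Sum>i\<in>T. (1 / m) *\<^sub>R w i) powr s \<le> (\<Sum>i\<in>T. (1 / m) * w i powr s)"
      using fT False m
      by (intro convex_on_sum[where C = "{0<..}"] powr_convex assms) (auto simp: m_def T_def)
    moreover have "(\<Sum>i\<in>T. (1 / m) *\<^sub>R w i) = (\<Sum>i\<in>T. w i) / m"
      by (simp add: sum_divide_distrib)
    moreover have "(\<Sum>i\<in>T. (1 / m) * w i powr s) = (\<Sum>i\<in>T. w i powr s) / m"
      by (simp add: sum_divide_distrib)
    moreover have "(\<Sum>i\<in>T. w i) \<ge> 0"
      by (intro sum_nonneg) (auto simp: T_def)
    ultimately have "(\<Sum>i\<in>T. w i) powr s / m powr s \<le> (\<Sum>i\<in>T. w i powr s) / m"
      using m by (simp add: powr_divide)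
    then have "(\<Sum>i\<in>T. w i) powr s \<le> m powr (s - 1) * (\<Sum>i\<in>T. w i powr s)"
      using m by (simp add: powr_diff field_simps)
    also have "\<dots> \<le> real (card S) powr (s - 1) * (\<Sum>i\<in>T. w i powr s)"
      unfolding m_def using assms card_mono[OF assms(1) TS]
      by (intro mult_right_mono powr_mono2 sum_nonneg) auto
    finally show ?thesis by (simp add: w ws)
  qed
qed

text \<open>
  The largest \<open>p\<close>-norm of a point of the Euclidean unit ball of dimension \<open>d\<close>, for \<open>p \<ge> 1\<close>.
\<close>

definition lp_radius :: "nat \<Rightarrow> ereal \<Rightarrow> real" where
  "lp_radius d p = (if p \<le> 2 then real d powr (1 / real_of_ereal p - 1 / 2) else 1)"

text \<open>
  Both bounds are power mean inequalities: the lower one compares the means of order \<open>1\<close> and \<open>p\<close>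
  of the coordinates, and the upper one those of order \<open>p\<close> and \<open>2\<close>. On the normalised diagonal
  all power means coincide, so this is the direction in which both are attained.
\<close>

lemma lp_norm_extremal_direction_le_2:
  fixes p :: ereal
  assumes "1 \<le> p" "p \<le> 2"
  defines "K \<equiv> real CARD('d::finite) powr (1 / real_of_ereal p - 1 / 2)"
  shows "\<exists>u :: real ^ 'd. norm u = 1 \<and> (\<forall>z. K * (z \<bullet> u) \<le> lp_norm p z \<and> lp_norm p z \<le> K * norm z)"
proof -
  obtain q where q: "p = ereal q" "1 \<le> q" "q \<le> 2"
    using assms by (cases p) auto
  define d where "d = real CARD('d)"
  have d: "d > 0" by (simp add: d_def)
  define u :: "real ^ 'd" where "u = (\<chi> i. 1 / sqrt d)"
  have "norm u = 1"
    using d by (simp add: norm_vec_def L2_set_def u_def power_divide d_def)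
  moreover have "K * (z \<bullet> u) \<le> lp_norm p z" for z
  proof -
    have N: "(\<Sum>i\<in>UNIV. \<bar>z $ i\<bar>) powr q \<le> d powr (q - 1) * (\<Sum>i\<in>UNIV. \<bar>z $ i\<bar> powr q)"
      using powr_sum_le[of UNIV q "\<lambda>i. \<bar>z $ i\<bar>"] q by (simp add: d_def)
    have "(\<Sum>i\<in>UNIV. \<bar>z $ i\<bar>) = ((\<Sum>i\<in>UNIV. \<bar>z $ i\<bar>) powr q) powr (1 / q)"
      using q by (simp add: powr_powr sum_nonneg)
    also have "\<dots> \<le> (d powr (q - 1) * (\<Sum>i\<in>UNIV. \<bar>z $ i\<bar> powr q)) powr (1 / q)"
      using q by (intro powr_mono2 N) auto
    also have "\<dots> = d powr (1 - 1 / q) * lp_norm p z"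
      using q by (simp add: powr_mult powr_powr lp_norm_def sum_nonneg diff_divide_distrib)
    finally have S: "(\<Sum>i\<in>UNIV. \<bar>z $ i\<bar>) \<le> d powr (1 - 1 / q) * lp_norm p z" .
    have "z \<bullet> u = (\<Sum>i\<in>UNIV. z $ i) * d powr (- (1 / 2))"
      using d by (simp add: inner_vec_def u_def sum_distrib_right powr_minus_divide powr_half_sqrt sum_divide_distrib)
    also have "\<dots> \<le> (\<Sum>i\<in>UNIV. \<bar>z $ i\<bar>) * d powr (- (1 / 2))"
      by (intro mult_right_mono sum_mono) auto
    also have "\<dots> \<le> d powr (1 - 1 / q) * lp_norm p z * d powr (- (1 / 2))"
      by (intro mult_right_mono S) auto
    finally have "K * (z \<bullet> u) \<le> K * (d powr (1 - 1 / q) * lp_norm p z * d powr (- (1 / 2)))"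
      by (intro mult_left_mono) (auto simp: K_def)
    also have "\<dots> = d powr ((1 / q - 1 / 2) + (1 - 1 / q) + (- (1 / 2))) * lp_norm p z"
      unfolding powr_add by (simp add: K_def q d_def)
    also have "\<dots> = lp_norm p z" using d by simp
    finally show ?thesis .
  qed
  moreover have "lp_norm p z \<le> K * norm z" for z :: "real ^ 'd"
  proof -
    have N: "(\<Sum>i\<in>UNIV. \<bar>z $ i\<bar> powr q) powr (2 / q)
        \<le> d powr (2 / q - 1) * (\<Sum>i\<in>UNIV. (\<bar>z $ i\<bar> powr q) powr (2 / q))"
      using powr_sum_le[of UNIV "2 / q" "\<lambda>i. \<bar>z $ i\<bar> powr q"] q by (simp add: d_def)
    have "(\<Sum>i\<in>UNIV. (\<bar>z $ i\<bar> powr q) powr (2 / q)) = (norm z)\<^sup>2"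
      using q by (simp add: powr_powr norm_vec_def L2_set_def sum_nonneg)
    then have "(\<Sum>i\<in>UNIV. \<bar>z $ i\<bar> powr q) powr (2 / q) \<le> d powr (2 / q - 1) * (norm z)\<^sup>2"
      using N by simp
    then have "((\<Sum>i\<in>UNIV. \<bar>z $ i\<bar> powr q) powr (2 / q)) powr (1/2) \<le> (d powr (2 / q - 1) * (norm z)\<^sup>2) powr (1/2)"
      by (intro powr_mono2) auto
    also have "\<dots> = K * norm z"
      using q d by (simp add: powr_mult powr_powr K_def powr_half_sqrt diff_divide_distrib flip: d_def)
    finally show ?thesis using q by (simp add: powr_powr lp_norm_def)
  qed
  ultimately show ?thesis by blast
qed

text \<open>
  For \<open>p \<ge> 2\<close> the \<open>p\<close>-norm lies between the absolute value of any single coordinate and the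
  Euclidean norm, so every coordinate vector is extremal.
\<close>

lemma lp_norm_extremal_direction_ge_2:
  fixes p :: ereal
  assumes "2 \<le> p"
  shows "\<exists>u :: real ^ 'd::finite. norm u = 1 \<and> (\<forall>z. z \<bullet> u \<le> lp_norm p z \<and> lp_norm p z \<le> norm z)"
proof -
  fix k :: 'd
  have dom: "\<bar>z $ k\<bar> \<le> lp_norm p z \<and> lp_norm p z \<le> norm z" for z :: "real ^ 'd"
  proof (cases "p = \<infinity>")
    case True
    then show ?thesis
      by (auto simp: lp_norm_def component_le_norm_cart intro!: Max_ge Max.boundedI)
  next
    case False
    then obtain q where q: "p = ereal q" "2 \<le> q"
      using assms by (cases p) auto
    have "\<bar>z $ k\<bar> powr q \<le> (\<Sum>i\<in>UNIV. \<bar>z $ i\<bar> powr q)"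
      by (rule member_le_sum) auto
    then have "(\<bar>z $ k\<bar> powr q) powr (1 / q) \<le> (\<Sum>i\<in>UNIV. \<bar>z $ i\<bar> powr q) powr (1 / q)"
      using q by (intro powr_mono2) auto
    then have lower: "\<bar>z $ k\<bar> \<le> lp_norm p z"
      using q by (simp add: lp_norm_def powr_powr)
    have split: "a powr q = a\<^sup>2 * a powr (q - 2)" if "a \<ge> 0" for a :: real
      using that powr_add[of a 2 "q - 2"] by simp
    have "(\<Sum>i\<in>UNIV. \<bar>z $ i\<bar> powr q) \<le> (\<Sum>i\<in>UNIV. (z $ i)\<^sup>2 * norm z powr (q - 2))"
      using q component_le_norm_cart[of z]
      by (intro sum_mono) (auto simp: split intro!: mult_left_mono powr_mono2)
    also have "\<dots> = (norm z)\<^sup>2 * norm z powr (q - 2)"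
      by (simp add: norm_vec_def L2_set_def sum_nonneg sum_distrib_right)
    also have "\<dots> = norm z powr q" by (simp add: split)
    finally have "(\<Sum>i\<in>UNIV. \<bar>z $ i\<bar> powr q) powr (1 / q) \<le> (norm z powr q) powr (1 / q)"
      using q by (intro powr_mono2 sum_nonneg) auto
    then show ?thesis using q lower by (simp add: lp_norm_def powr_powr)
  qed
  have "z \<bullet> axis k 1 \<le> lp_norm p z \<and> lp_norm p z \<le> norm z" for z
    using dom[of z] abs_ge_self[of "z $ k"] by (simp add: inner_axis)
  then show ?thesis by (intro exI[of _ "axis k 1"]) simp
qed

lemma lp_norm_extremal_direction:
  fixes p :: ereal
  assumes "1 \<le> p"
  obtains u :: "real ^ 'd::finite" where "norm u = 1"
    and "\<And>z. lp_radius CARD('d) p * (z \<bullet> u) \<le> lp_norm p z"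
    and "\<And>z :: real ^ 'd. lp_norm p z \<le> lp_radius CARD('d) p * norm z"
proof (cases "p \<le> 2")
  case True
  then have K: "lp_radius CARD('d) p = real CARD('d) powr (1 / real_of_ereal p - 1 / 2)"
    by (simp only: lp_radius_def if_True)
  obtain u :: "real ^ 'd" where "norm u = 1"
    "\<forall>z. lp_radius CARD('d) p * (z \<bullet> u) \<le> lp_norm p z \<and> lp_norm p z \<le> lp_radius CARD('d) p * norm z"
    unfolding K using lp_norm_extremal_direction_le_2[OF assms True] by blast
  then show ?thesis by (intro that[of u]) auto
next
  case False
  then have K: "lp_radius CARD('d) p = 1" by (simp only: lp_radius_def if_False)
  obtain u :: "real ^ 'd" where "norm u = 1" "\<forall>z. z \<bullet> u \<le> lp_norm p z \<and> lp_norm p z \<le> norm z"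
    using lp_norm_extremal_direction_ge_2[of p] False by force
  then show ?thesis by (intro that[of u]) (auto simp: K)
qed

lemma lp_radius_pos: "d > 0 \<Longrightarrow> lp_radius d p > 0"
  by (simp add: lp_radius_def)

lemma lp_diam_unit_ball:
  assumes "1 \<le> p"
  shows "lp_diam p (cball 0 1 :: (real ^ 'd::finite) set) = 2 * lp_radius CARD('d) p"
proof -
  define K where "K = lp_radius CARD('d) p"
  have K: "K > 0" by (simp add: K_def lp_radius_pos)
  obtain u :: "real ^ 'd" where u: "norm u = 1"
    "\<And>z. K * (z \<bullet> u) \<le> lp_norm p z" "\<And>z :: real ^ 'd. lp_norm p z \<le> K * norm z"
    using lp_norm_extremal_direction[OF assms, where 'd = 'd] unfolding K_def by metis
  have le: "lp_norm p (x - y) \<le> 2 * K" if "x \<in> cball 0 1" "y \<in> cball 0 1" for x y :: "real ^ 'd"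
  proof -
    have "norm (x - y) \<le> 2"
      using that norm_triangle_ineq4[of x y] by simp
    then have "K * norm (x - y) \<le> K * 2" using K by simp
    then show ?thesis using u(3)[of "x - y"] by linarith
  qed
  have "(u - (- u)) \<bullet> u = 2"
    by (simp only: inner_diff_left inner_minus_left dot_square_norm u) simp
  then have "2 * K \<le> lp_norm p (u - (- u))"
    using u(2)[of "u - (- u)"] by (metis mult.commute)
  moreover have "lp_norm p (u - (- u)) \<le> 2 * K"
    by (rule le) (simp_all add: u(1))
  ultimately have "lp_norm p (u - (- u)) = 2 * K" by (rule antisym[rotated])
  moreover have "u \<in> cball 0 1" "- u \<in> cball 0 1"
    using u(1) by simp_all
  ultimately have "2 * K \<in> {lp_norm p (x - y) | x y :: real ^ 'd. x \<in> cball 0 1 \<and> y \<in> cball 0 1}"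
    by (metis (mono_tags, lifting) mem_Collect_eq)
  then show ?thesis
    unfolding lp_diam_def K_def[symmetric] by (rule cSup_eq_maximum) (use le in auto)
qed

section \<open>Graph distance and displacement\<close>

text \<open>
  An edge moves by a vector \<open>z\<close> with \<open>K * (z \<bullet> u) \<le> lp_norm p z \<le> r\<close>, and the displacements
  in direction \<open>u\<close> add up along the path.
\<close>

lemma path_displacement:
  fixes x y u :: "real ^ 'd::finite"
  assumes u: "\<And>z :: real ^ 'd. K * (z \<bullet> u) \<le> lp_norm p z"
    and "is_path V (geom_adj p r) x y xs"
  shows "K * ((x - y) \<bullet> u) \<le> r * real (length xs - 1)"
proof -
  have "K * ((hd xs - last xs) \<bullet> u) \<le> r * real (length xs - 1)"
    if "xs \<noteq> []" "successively (geom_adj p r) xs" for xs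
    using that
  proof (induction xs)
    case (Cons a xs)
    show ?case
    proof (cases xs)
      case (Cons b ys)
      have "K * ((a - b) \<bullet> u) \<le> r"
        using u[of "a - b"] Cons.prems Cons by (auto simp: geom_adj_def)
      moreover have "K * ((b - last xs) \<bullet> u) \<le> r * real (length ys)"
        using Cons.IH Cons.prems Cons by simp
      ultimately show ?thesis
        using Cons by (simp add: inner_diff_left algebra_simps)
    qed simp
  qed simp
  then show ?thesis using assms(2) by (auto simp: is_path_def)
qed

text \<open>
  A real lower bound on an integer-valued distance is an integer lower bound; this moves the
  comparison to \<open>enat\<close>, where the infimum and the maximum that define the diameter are taken.
\<close>

lemma ereal_le_enat_iff: "ereal c \<le> ereal_of_enat e \<longleftrightarrow> enat (nat \<lceil>c\<rceil>) \<le> e"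
  by (cases e) (auto simp: le_nat_iff ceiling_le_iff nat_le_iff)

lemma graph_diam_ge_iff:
  assumes "finite V" "V \<noteq> {}"
  shows "m \<le> graph_diam V adj \<longleftrightarrow>
    (\<exists>x\<in>V. \<exists>y\<in>V. \<forall>xs. is_path V adj x y xs \<longrightarrow> m \<le> enat (length xs - 1))"
proof -
  have "{graph_dist V adj x y | x y. x \<in> V \<and> y \<in> V} = (\<lambda>(x, y). graph_dist V adj x y) ` (V \<times> V)"
    by auto
  then show ?thesis
    unfolding graph_diam_def using assms
    by (subst Max_ge_iff) (auto simp: graph_dist_def le_INF_iff)
qed

lemma rgg_diam_ge:
  fixes X :: "nat \<Rightarrow> real ^ 'd::finite"
  assumes "r > 0" and u: "\<And>z :: real ^ 'd. K * (z \<bullet> u) \<le> lp_norm p z"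
    and ij: "i < n" "j < n" and c: "r * c \<le> K * ((X i - X j) \<bullet> u)"
  shows "ereal c \<le> ereal_of_enat (rgg_diam p r n X)"
proof -
  have "enat (nat \<lceil>c\<rceil>) \<le> enat (length xs - 1)"
    if "is_path (X ` {..<n}) (geom_adj p r) (X i) (X j) xs" for xs
  proof -
    have "r * c \<le> r * real (length xs - 1)"
      using path_displacement[OF u that] c by linarith
    then have "c \<le> real (length xs - 1)" using \<open>r > 0\<close> by simp
    then show ?thesis by (simp add: nat_le_iff ceiling_le_iff)
  qed
  then show ?thesis
    unfolding ereal_le_enat_iff rgg_diam_def using ij
    by (subst graph_diam_ge_iff) auto
qed

section \<open>Measurability of the diameter\<close>

text \<open>
  Paths between random points are described by lists of indices. Unlike the vertex set, the set
  of these lists is fixed and countable, which makes quantification over paths measurable.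
\<close>

lemma is_path_image_iff:
  "is_path (f ` I) adj x y xs \<longleftrightarrow> (\<exists>js\<in>lists I. xs = map f js \<and> js \<noteq> [] \<and> f (hd js) = x \<and>
     f (last js) = y \<and> distinct (map f js) \<and> successively (\<lambda>a b. adj (f a) (f b)) js)"
proof
  assume path: "is_path (f ` I) adj x y xs"
  then have "xs \<in> lists (f ` I)" by (auto simp: is_path_def)
  then obtain js where js: "js \<in> lists I" "xs = map f js" by (auto simp: lists_image)
  then have "js \<noteq> []" using path by (auto simp: is_path_def)
  with js path show "\<exists>js\<in>lists I. xs = map f js \<and> js \<noteq> [] \<and> f (hd js) = x \<and>
     f (last js) = y \<and> distinct (map f js) \<and> successively (\<lambda>a b. adj (f a) (f b)) js"
    by (intro bexI[of _ js]) (auto simp: is_path_def hd_map last_map successively_map)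
qed (auto simp: is_path_def hd_map last_map successively_map)

lemma borel_measurable_lp_norm [measurable]:
  "(lp_norm p :: real ^ 'd::finite \<Rightarrow> real) \<in> borel_measurable borel"
proof -
  have [measurable]: "(\<lambda>x :: real ^ 'd. x $ i) \<in> borel_measurable borel" for i :: 'd
    by (intro borel_measurable_continuous_onI continuous_intros)
  show ?thesis
    unfolding lp_norm_def[abs_def]
    by (cases "p = \<infinity>") (simp_all, measurable)
qed

lemma measurable_ball_point:
  "i < n \<Longrightarrow> (\<lambda>X. X i) \<in> borel_measurable (ball_points n :: (nat \<Rightarrow> real ^ 'd::finite) measure)"
  using measurable_component_singleton[of i "{..<n}" "\<lambda>_. uniform_measure lborel (cball 0 1 :: (real ^ 'd) set)"]
  by (simp add: ball_points_def cong: measurable_cong_sets)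

text \<open>
  The event is a countable Boolean combination of the events that two points coincide and that two
  points are adjacent, the combinations ranging over pairs of indices and lists of indices.
\<close>

lemma measurable_rgg_diam_ge:
  "{X \<in> space (ball_points n). ereal c \<le> ereal_of_enat (rgg_diam p r n (X :: nat \<Rightarrow> real ^ 'd::finite))}
     \<in> sets (ball_points n)"
proof (cases "n = 0")
  case True
  then show ?thesis by (simp add: rgg_diam_def)
next
  case False
  define M :: "(nat \<Rightarrow> real ^ 'd) measure" where "M = ball_points n"
  have comp: "(\<lambda>X. X i) \<in> borel_measurable M" if "i < n" for i
    unfolding M_def using that by (rule measurable_ball_point)
  have eq: "{X \<in> space M. X i = X j} \<in> sets M" if "i < n" "j < n" for i j
  proof -
    note [measurable] = comp[OF that(1)] comp[OF that(2)]
    have "{X \<in> space M. X i - X j \<in> {0}} \<in> sets M" by measurable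
    then show ?thesis by simp
  qed
  have adj: "{X \<in> space M. geom_adj p r (X i) (X j)} \<in> sets M" if "i < n" "j < n" for i j
  proof -
    note [measurable] = comp[OF that(1)] comp[OF that(2)]
    have "{X \<in> space M. lp_norm p (X i - X j) \<le> r} \<in> sets M" by measurable
    then show ?thesis
      unfolding geom_adj_def by (intro sets.sets_Collect eq that)
  qed
  have path: "{X \<in> space M. js \<noteq> [] \<and> X (hd js) = X i \<and> X (last js) = X j \<and> distinct (map X js) \<and>
           successively (\<lambda>a b. geom_adj p r (X a) (X b)) js} \<in> sets M"
    if "i < n" "j < n" "js \<in> lists {..<n}" for i j js
  proof (cases "js = []")
    case False
    then have mem: "hd js < n" "last js < n" "\<And>k. k < length js \<Longrightarrow> js ! k < n"
      using that(3) hd_in_set[of js] last_in_set[of js] by (auto simp: subset_iff)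
    have dist: "distinct (map X js) \<longleftrightarrow>
        (\<forall>k\<in>{..<length js}. \<forall>l\<in>{..<length js}. k \<noteq> l \<longrightarrow> \<not> X (js ! k) = X (js ! l))" for X :: "nat \<Rightarrow> real ^ 'd"
      by (auto simp: distinct_conv_nth)
    have succ: "successively (\<lambda>a b. geom_adj p r (X a) (X b)) js \<longleftrightarrow>
        (\<forall>k\<in>{..<length js - 1}. geom_adj p r (X (js ! k)) (X (js ! Suc k)))" for X :: "nat \<Rightarrow> real ^ 'd"
      by (auto simp: successively_conv_nth)
    show ?thesis
      unfolding dist succ using that mem
      by (intro sets.sets_Collect sets.sets_Collect_finite_All eq adj) auto
  qed simp
  have "(\<forall>xs. is_path (X ` {..<n}) (geom_adj p r) (X i) (X j) xs \<longrightarrow> m \<le> enat (length xs - 1)) \<longleftrightarrow>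
    (\<forall>js\<in>lists {..<n}. js \<noteq> [] \<and> X (hd js) = X i \<and> X (last js) = X j \<and>
           distinct (map X js) \<and> successively (\<lambda>a b. geom_adj p r (X a) (X b)) js
         \<longrightarrow> m \<le> enat (length js - 1))" for X :: "nat \<Rightarrow> real ^ 'd" and i j m
    unfolding is_path_image_iff by auto
  moreover have "ereal c \<le> ereal_of_enat (rgg_diam p r n X) \<longleftrightarrow>
      (\<exists>i\<in>{..<n}. \<exists>j\<in>{..<n}. \<forall>xs. is_path (X ` {..<n}) (geom_adj p r) (X i) (X j) xs
         \<longrightarrow> enat (nat \<lceil>c\<rceil>) \<le> enat (length xs - 1))" for X :: "nat \<Rightarrow> real ^ 'd"
  proof -
    have V: "finite (X ` {..<n})" "X ` {..<n} \<noteq> {}" using False by auto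
    show ?thesis
      unfolding ereal_le_enat_iff rgg_diam_def graph_diam_ge_iff[OF V] by blast
  qed
  moreover have "{X \<in> space M. \<exists>i\<in>{..<n}. \<exists>j\<in>{..<n}. \<forall>js\<in>lists {..<n}. js \<noteq> [] \<and> X (hd js) = X i \<and> X (last js) = X j \<and>
           distinct (map X js) \<and> successively (\<lambda>a b. geom_adj p r (X a) (X b)) js
         \<longrightarrow> enat (nat \<lceil>c\<rceil>) \<le> enat (length js - 1)} \<in> sets M"
    by (intro sets.sets_Collect_countable_Ex' sets.sets_Collect_countable_All' sets.sets_Collect_imp
          path sets.sets_Collect_const countable_lists) auto
  ultimately show ?thesis
    unfolding M_def by (simp only:)
qed

section \<open>Volume of a cap of the unit ball\<close>

lemma emeasure_unit_ball:
  "emeasure lborel (cball 0 1 :: 'a::euclidean_space set) \<noteq> 0"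
  "emeasure lborel (cball 0 1 :: 'a::euclidean_space set) \<noteq> \<infinity>"
  using content_cball_pos[of 1 "0 :: 'a"] emeasure_lborel_cball_finite[of "0 :: 'a" 1]
  by (auto simp: measure_def less_top)

text \<open>
  Lebesgue measure is invariant under orthogonal maps. The argument is the one for uniqueness of
  Haar measure: for the unit ball \<open>B\<close>, the product \<open>emeasure lborel (f -` A) * emeasure lborel B\<close>
  is the integral of \<open>indicator A (f x) * indicator B y\<close> over all pairs \<open>(x, y)\<close>. Translating
  first \<open>x\<close>, by the preimage of \<open>y\<close>, and then \<open>y\<close>, by \<open>- f x\<close>, turns the integrand into
  \<open>indicator A y * indicator B (y - f x)\<close>. Since \<open>f\<close> is an isometry, the points \<open>x\<close> with
  \<open>y - f x \<in> B\<close> form a unit ball, whatever \<open>y\<close> is, so the integral is also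
  \<open>emeasure lborel A * emeasure lborel B\<close>.
\<close>

lemma emeasure_orthogonal_vimage:
  fixes f :: "'a::euclidean_space \<Rightarrow> 'a"
  assumes f: "orthogonal_transformation f" and A: "A \<in> sets borel"
  shows "emeasure lborel (f -` A) = emeasure lborel A"
proof -
  have lin: "linear f" using f by (rule orthogonal_transformation_linear)
  have [measurable]: "f \<in> borel_measurable borel"
    using linear_conv_bounded_linear lin
    by (intro borel_measurable_continuous_onI) (auto intro: linear_continuous_on)
  note [measurable] = A
  have bij: "bij f" using f by (rule orthogonal_transformation_bij)
  define g where "g = inv f"
  have fg: "f (g y) = y" for y using bij by (simp add: g_def bij_is_surj surj_f_inv_f)
  define B :: "'a set" where "B = cball 0 1"
  have [measurable]: "B \<in> sets borel" by (simp add: B_def)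
  have shift: "(\<integral>\<^sup>+x. F (t + x) \<partial>lborel) = (\<integral>\<^sup>+x. F x \<partial>lborel)"
    if "F \<in> borel_measurable borel" for F :: "'a \<Rightarrow> ennreal" and t
    using nn_integral_distr[of "(+) t" lborel borel F] that by (simp add: lborel_distr_plus)
  have "emeasure lborel (f -` A) * emeasure lborel B
      = (\<integral>\<^sup>+y. (\<integral>\<^sup>+x. indicator A (f x) \<partial>lborel) * indicator B y \<partial>lborel)"
  proof -
    have "(\<integral>\<^sup>+x. indicator A (f x) \<partial>lborel) = emeasure lborel (f -` A)"
      using measurable_sets_borel[of f borel A] by (simp add: indicator_vimage[symmetric])
    then show ?thesis by (simp add: nn_integral_cmult)
  qed
  also have "\<dots> = (\<integral>\<^sup>+y. (\<integral>\<^sup>+x. indicator A (y + f x) * indicator B y \<partial>lborel) \<partial>lborel)"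
  proof (rule nn_integral_cong)
    fix y
    have "(\<integral>\<^sup>+x. indicator A (f (g y + x)) \<partial>lborel) = (\<integral>\<^sup>+x. indicator A (f x) \<partial>lborel)"
      by (rule shift) measurable
    then show "(\<integral>\<^sup>+x. indicator A (f x) \<partial>lborel) * indicator B y
        = (\<integral>\<^sup>+x. indicator A (y + f x) * indicator B y \<partial>lborel)"
      by (simp add: linear_add[OF lin] fg nn_integral_multc)
  qed
  also have "\<dots> = (\<integral>\<^sup>+x. (\<integral>\<^sup>+y. indicator A (y + f x) * indicator B y \<partial>lborel) \<partial>lborel)"
    by (rule lborel_pair.Fubini') measurable
  also have "\<dots> = (\<integral>\<^sup>+x. (\<integral>\<^sup>+y. indicator A y * indicator B (y - f x) \<partial>lborel) \<partial>lborel)"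
  proof (rule nn_integral_cong)
    fix x
    show "(\<integral>\<^sup>+y. indicator A (y + f x) * indicator B y \<partial>lborel)
        = (\<integral>\<^sup>+y. indicator A y * indicator B (y - f x) \<partial>lborel)"
      using shift[of "\<lambda>y. indicator A y * indicator B (y - f x)" "f x"] by (simp add: add.commute)
  qed
  also have "\<dots> = (\<integral>\<^sup>+y. (\<integral>\<^sup>+x. indicator A y * indicator B (y - f x) \<partial>lborel) \<partial>lborel)"
    by (rule lborel_pair.Fubini') measurable
  also have "\<dots> = (\<integral>\<^sup>+y. indicator A y * emeasure lborel B \<partial>lborel)"
  proof (rule nn_integral_cong)
    fix y
    have "indicator B (y - f x) = (indicator (cball (g y) 1) x :: ennreal)" for x
    proof -
      have "y - f x = f (g y - x)" by (simp add: linear_diff[OF lin] fg)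
      then show ?thesis
        using orthogonal_transformation_norm[OF f, of "g y - x"]
        by (simp add: B_def indicator_def dist_norm)
    qed
    moreover have "emeasure lborel (cball (g y) 1) = emeasure lborel B"
      unfolding B_def by (simp add: emeasure_cball)
    ultimately show "(\<integral>\<^sup>+x. indicator A y * indicator B (y - f x) \<partial>lborel)
        = indicator A y * emeasure lborel B"
      by (subst nn_integral_cmult) (auto intro!: borel_measurable_indicator)
  qed
  also have "\<dots> = emeasure lborel A * emeasure lborel B"
    by (simp add: nn_integral_multc)
  finally show ?thesis
    using emeasure_unit_ball[where 'a = 'a]
    by (simp add: B_def mult.commute[of _ "emeasure lborel (cball 0 1)"] ennreal_mult_cancel_left)
qed

text \<open>
  By rotation invariance the axis of the cap may be taken to be a coordinate axis. The cap then
  contains a box of side \<open>h / 2\<close> along the axis and side \<open>2 * sqrt (h / (2 * d))\<close> in the other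
  \<open>d - 1\<close> directions, and the bound is the volume of this box.
\<close>

lemma cap_volume_ge:
  fixes u :: "real ^ 'd::finite"
  assumes "norm u = 1" and h: "0 \<le> h" "h \<le> 1"
  defines "d \<equiv> CARD('d)"
  shows "h powr ((real d + 1) / 2) * (1 / 2 * (2 / real d) powr ((real d - 1) / 2))
     \<le> measure lborel (cball 0 1 \<inter> {x. 1 - h \<le> x \<bullet> u})"
proof -
  fix k :: 'd
  define s where "s = sqrt (h / (2 * real d))"
  have d: "real d > 0" and s: "s \<ge> 0" and s2: "real d * s\<^sup>2 = h / 2"
    using h by (simp_all add: d_def s_def)
  \<comment> \<open>The box stays in the ball: with \<open>real d * s\<^sup>2 = h / 2\<close> and \<open>h \<le> 1\<close>, its points satisfy
    \<open>(norm x)\<^sup>2 \<le> (1 - h / 2)\<^sup>2 + h / 2 = 1 - h / 2 + h\<^sup>2 / 4 \<le> 1\<close>.\<close>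
  define a b :: "real ^ 'd" where "a = (\<chi> i. if i = k then 1 - h else - s)"
    and "b = (\<chi> i. if i = k then 1 - h / 2 else s)"
  have box: "norm x \<le> 1 \<and> 1 - h \<le> x $ k" if "x \<in> cbox a b" for x
  proof -
    have xk: "1 - h \<le> x $ k" "x $ k \<le> 1 - h / 2" and xi: "\<And>i. i \<noteq> k \<Longrightarrow> \<bar>x $ i\<bar> \<le> s"
      using that by (auto simp: mem_box_cart a_def b_def abs_le_iff split: if_splits dest: spec[of _ k])
    have "(norm x)\<^sup>2 = (\<Sum>i\<in>UNIV. (x $ i)\<^sup>2)"
      by (simp add: norm_vec_def L2_set_def sum_nonneg)
    also have "\<dots> = (x $ k)\<^sup>2 + (\<Sum>i\<in>UNIV - {k}. (x $ i)\<^sup>2)"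
      by (simp add: sum.remove[of UNIV k])
    also have "\<dots> \<le> (1 - h / 2)\<^sup>2 + (\<Sum>i\<in>UNIV - {k}. s\<^sup>2)"
    proof (intro add_mono sum_mono)
      show "(x $ k)\<^sup>2 \<le> (1 - h / 2)\<^sup>2" using xk h by (intro power_mono) auto
      fix i assume "i \<in> UNIV - {k}"
      then show "(x $ i)\<^sup>2 \<le> s\<^sup>2"
        using xi[of i] s by (simp flip: abs_le_square_iff)
    qed
    also have "(\<Sum>i\<in>UNIV - {k}. s\<^sup>2) \<le> real d * s\<^sup>2"
      by (simp add: d_def mult_right_mono)
    also have "(1 - h / 2)\<^sup>2 + real d * s\<^sup>2 \<le> 1"
    proof -
      have "h * h \<le> h * 1" using h by (intro mult_left_mono)
      then show ?thesis unfolding s2 using h by (simp add: power2_eq_square algebra_simps)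
    qed
    finally show ?thesis using xk by (simp add: power_le_one_iff abs_square_le_1)
  qed
  obtain f :: "real ^ 'd \<Rightarrow> real ^ 'd" where f: "orthogonal_transformation f" "f (axis k 1) = u"
    by (rule orthogonal_transformation_exists_1[of "axis k 1" u]) (simp_all add: assms(1))
  define cap where "cap v = cball 0 1 \<inter> {x. 1 - h \<le> x \<bullet> v}" for v :: "real ^ 'd"
  have compact: "compact (cap v)" for v
    unfolding cap_def by (intro compact_Int_closed compact_cball closed_Collect_le continuous_intros)
  have "f -` cap u = cap (axis k 1)"
    unfolding cap_def f(2)[symmetric] using f(1)
    by (auto simp: orthogonal_transformation_norm orthogonal_transformation_def)
  then have "measure lborel (cap u) = measure lborel (cap (axis k 1))"
    using emeasure_orthogonal_vimage[OF f(1), of "cap u"] compact[of u]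
    by (simp add: measure_def borel_compact)
  moreover have "measure lborel (cbox a b) \<le> measure lborel (cap (axis k 1))"
  proof (rule measure_mono_fmeasurable)
    show "cbox a b \<subseteq> cap (axis k 1)" using box by (auto simp: cap_def inner_axis)
    show "cap (axis k 1) \<in> fmeasurable lborel"
      by (intro fmeasurableI emeasure_compact_finite compact) (simp add: compact borel_compact)
  qed simp
  moreover have "measure lborel (cbox a b) = h / 2 * (2 * s) ^ (d - 1)"
  proof -
    have "cbox a b \<noteq> {}" using h s by (auto simp: interval_ne_empty_cart a_def b_def)
    then have "measure lborel (cbox a b) = (\<Prod>i\<in>UNIV. b $ i - a $ i)"
      by (simp add: content_cbox_cart)
    also have "\<dots> = h / 2 * (\<Prod>i\<in>UNIV - {k}. 2 * s)"
      by (subst prod.remove[of UNIV k]) (auto simp: a_def b_def intro!: prod.cong)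
    finally show ?thesis by (simp add: d_def)
  qed
  moreover have "h / 2 * (2 * s) ^ (d - 1) = h powr ((real d + 1) / 2) * (1 / 2 * (2 / real d) powr ((real d - 1) / 2))"
  proof (cases "h = 0")
    case False
    define y where "y = 2 / real d"
    have pos: "h > 0" "y > 0" using h False d by (simp_all add: y_def)
    have "2 * s = sqrt 4 * s" by simp
    also have "\<dots> = sqrt (4 * (h / (2 * real d)))"
      by (simp only: s_def real_sqrt_mult)
    also have "4 * (h / (2 * real d)) = h * y" by (simp add: y_def)
    finally have "2 * s = (h * y) powr (1 / 2)"
      using pos by (simp add: powr_half_sqrt)
    moreover have "real (d - 1) = real d - 1" using d by (simp add: of_nat_diff)
    ultimately have "(2 * s) ^ (d - 1) = ((h * y) powr (1 / 2)) powr (real d - 1)"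
      using pos by (metis powr_realpow powr_gt_zero mult_pos_pos less_irrefl)
    also have "\<dots> = h powr ((real d - 1) / 2) * y powr ((real d - 1) / 2)"
      using pos by (simp add: powr_powr powr_mult)
    finally have "h / 2 * (2 * s) ^ (d - 1) = (h powr 1 * h powr ((real d - 1) / 2)) * (1 / 2 * y powr ((real d - 1) / 2))"
      using pos by simp
    also have "h powr 1 * h powr ((real d - 1) / 2) = h powr ((real d + 1) / 2)"
      unfolding powr_add[symmetric] by (rule arg_cong[where f = "\<lambda>t. h powr t"]) (simp add: field_simps)
    finally show ?thesis unfolding y_def .
  qed (simp add: d_def)
  ultimately show ?thesis by (simp add: cap_def)
qed

section \<open>Sampling points in a cap\<close>

lemma ball_prob_space:
  "prob_space (uniform_measure lborel (cball 0 1 :: (real ^ 'd::finite) set))"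
  by (intro prob_space_uniform_measure emeasure_unit_ball)

text \<open>
  By independence the probability is \<open>(1 - a) ^ n\<close>, and \<open>1 - a \<le> exp (- a)\<close>.
\<close>

lemma prob_no_ball_point_in:
  fixes A :: "(real ^ 'd::finite) set"
  assumes A: "A \<in> sets borel"
  defines "a \<equiv> measure lborel (cball 0 1 \<inter> A) / measure lborel (cball 0 1 :: (real ^ 'd) set)"
  shows "measure (ball_points n) {X \<in> space (ball_points n). \<forall>i\<in>{..<n}. X i \<in> - A} \<le> exp (- a * real n)"
proof -
  define U where "U = uniform_measure lborel (cball 0 1 :: (real ^ 'd) set)"
  interpret U: prob_space U unfolding U_def by (rule ball_prob_space)
  interpret P: product_prob_space "\<lambda>_. U" "{..<n}" by standard
  have setsU: "sets U = sets borel" "space U = UNIV" by (simp_all add: U_def)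
  have "measure U A = a"
    using A unfolding U_def a_def
    by (intro measure_uniform_measure emeasure_unit_ball) auto
  then have co: "measure U (- A) = 1 - a"
    using U.prob_compl[of A] A setsU by (simp add: Compl_eq_Diff_UNIV)
  have bp: "ball_points n = (\<Pi>\<^sub>M i\<in>{..<n}. U)" by (simp add: ball_points_def U_def)
  have "emeasure (ball_points n) {X \<in> space (ball_points n). \<forall>i\<in>{..<n}. X i \<in> - A}
      = (\<Prod>i\<in>{..<n}. emeasure U (- A))"
    unfolding bp by (rule P.emeasure_PiM_Collect) (use A setsU in auto)
  also have "\<dots> = ennreal ((1 - a) ^ n)"
    by (simp add: U.emeasure_eq_measure co ennreal_power flip: co)
  finally have "measure (ball_points n) {X \<in> space (ball_points n). \<forall>i\<in>{..<n}. X i \<in> - A} = (1 - a) ^ n"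
    using measure_nonneg[of U "- A"] by (simp add: measure_def flip: co)
  also have "\<dots> \<le> exp (- a) ^ n"
    using measure_nonneg[of U "- A"] exp_ge_add_one_self[of "- a"]
    by (intro power_mono) (simp_all flip: co)
  also have "\<dots> = exp (- a * real n)"
    by (simp add: mult.commute flip: exp_of_nat_mult)
  finally show ?thesis .
qed

text \<open>
  The quantitative form of the theorem. For \<open>h \<le> 1\<close> the event fails only if the cap around \<open>u\<close>
  or the cap around \<open>- u\<close> contains no vertex, and the two failure probabilities are added. For
  \<open>h > 1\<close> the required lower bound on the diameter is negative, so the event is certain.
\<close>

lemma prob_rgg_diam_ge:
  fixes p :: ereal and r h :: real and n :: nat
  assumes "1 \<le> p" "r > 0" "h \<ge> 0" "n \<ge> 1"
  defines "d \<equiv> real CARD('d::finite)"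
  defines "c \<equiv> 1 / 2 * (2 / d) powr ((d - 1) / 2) / measure lborel (cball 0 1 :: (real ^ 'd) set)"
  defines "M \<equiv> ball_points n :: (nat \<Rightarrow> real ^ 'd) measure"
  shows "1 - 2 * exp (- c * (h powr ((d + 1) / 2) * real n)) \<le>
    measure M {X \<in> space M. ereal ((1 - h) / r * lp_diam p (cball 0 1 :: (real ^ 'd) set))
                               \<le> ereal_of_enat (rgg_diam p r n X)}"
    (is "_ \<le> measure M {X \<in> space M. ?good X}")
proof -
  define K where "K = lp_radius CARD('d) p"
  have K: "K > 0" by (simp add: K_def lp_radius_pos)
  obtain u :: "real ^ 'd" where u: "norm u = 1" "\<And>z. K * (z \<bullet> u) \<le> lp_norm p z"
    using lp_norm_extremal_direction[OF assms(1), where 'd = 'd] unfolding K_def by metis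
  interpret M: prob_space M
    unfolding M_def ball_points_def by (intro prob_space_PiM ball_prob_space)
  note diam = lp_diam_unit_ball[OF assms(1), where 'd = 'd, folded K_def]
  have good: "{X \<in> space M. ?good X} \<in> M.events"
    unfolding M_def by (rule measurable_rgg_diam_ge)
  show ?thesis
  proof (cases "h \<le> 1")
    case False
    then have "r * ((1 - h) / r * (2 * K)) \<le> 0"
      using K \<open>r > 0\<close> by (simp add: mult_le_0_iff)
    then have "?good X" for X
      unfolding diam using rgg_diam_ge[OF \<open>r > 0\<close> u(2), of 0 n 0] \<open>n \<ge> 1\<close> by simp
    then have "measure M {X \<in> space M. ?good X} = 1" by (simp add: M.prob_space)
    then show ?thesis by simp
  next
    case True
    define miss where "miss v = {X \<in> space M. \<forall>i\<in>{..<n}. X i \<in> - {x. 1 - h \<le> x \<bullet> v}}" for v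
    have cap: "{x. 1 - h \<le> x \<bullet> v} \<in> sets borel" for v :: "real ^ 'd"
      by measurable
    have miss: "measure M (miss v) \<le> exp (- c * (h powr ((d + 1) / 2) * real n))" if "norm v = 1" for v
    proof -
      have "c * h powr ((d + 1) / 2) \<le> measure lborel (cball 0 1 \<inter> {x. 1 - h \<le> x \<bullet> v}) / measure lborel (cball 0 1 :: (real ^ 'd) set)"
        using divide_right_mono[OF cap_volume_ge[OF that \<open>h \<ge> 0\<close> True] measure_nonneg]
        by (simp add: c_def d_def mult_ac)
      then have "c * h powr ((d + 1) / 2) * real n \<le> measure lborel (cball 0 1 \<inter> {x. 1 - h \<le> x \<bullet> v}) / measure lborel (cball 0 1 :: (real ^ 'd) set) * real n"
        by (rule mult_right_mono) simp
      then show ?thesis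
        using prob_no_ball_point_in[OF cap, of n v] unfolding miss_def M_def
        by (elim order_trans) (simp add: mult_ac)
    qed
    have miss_sets: "miss v \<in> M.events" for v
    proof -
      have [measurable]: "(\<lambda>X. X i) \<in> borel_measurable M" if "i \<in> {..<n}" for i
        unfolding M_def using that by (intro measurable_ball_point) simp
      show ?thesis unfolding miss_def by measurable
    qed
    have "space M - {X \<in> space M. ?good X} \<subseteq> miss u \<union> miss (- u)"
    proof (rule subsetI, rule ccontr)
      fix X assume bad: "X \<in> space M - {X \<in> space M. ?good X}" and "X \<notin> miss u \<union> miss (- u)"
      then obtain i j where X: "i < n" "j < n" "1 - h \<le> X i \<bullet> u" "1 - h \<le> X j \<bullet> - u"
        by (auto simp: miss_def)
      have "K * (2 * (1 - h)) \<le> K * ((X i - X j) \<bullet> u)"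
        using X K by (intro mult_left_mono) (auto simp: inner_diff_left)
      then have "?good X"
        unfolding diam using \<open>r > 0\<close> X(1,2)
        by (intro rgg_diam_ge[OF \<open>r > 0\<close> u(2)]) (auto simp: mult_ac)
      with bad show False by simp
    qed
    then have "measure M (space M - {X \<in> space M. ?good X}) \<le> measure M (miss u \<union> miss (- u))"
      by (intro M.finite_measure_mono) (simp_all add: miss_sets sets.Un)
    also have "\<dots> \<le> measure M (miss u) + measure M (miss (- u))"
      by (intro measure_Un_le miss_sets)
    also have "\<dots> \<le> 2 * exp (- c * (h powr ((d + 1) / 2) * real n))"
      using miss[of u] miss[of "- u"] u(1) by simp
    finally show ?thesis
      using M.prob_compl[OF good] by linarith
  qed
qed

section \<open>The diameter of the random geometric graph\<close>

theorem proposition7: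
  fixes p :: ereal and r h :: "nat \<Rightarrow> real"
  assumes "1 \<le> p"
    and "\<And>n. n \<ge> 1 \<Longrightarrow> r n > 0"
    and "connectivity_regime TYPE('d::finite) p r"
    and "\<And>n. n \<ge> 1 \<Longrightarrow> h n \<ge> 0"
    and "filterlim (\<lambda>n. h n powr ((real CARD('d) + 1) / 2) * real n) at_top sequentially"
  shows "almost_always (\<lambda>n. ball_points n :: (nat \<Rightarrow> real ^ 'd) measure)
           (\<lambda>n X. ereal_of_enat (rgg_diam p (r n) n X)
                    \<ge> ereal ((1 - h n) / r n * lp_diam p (cball 0 1 :: (real ^ 'd) set)))
         \<and> (\<forall>n\<ge>1.
             (p \<le> 2 \<longrightarrow> (1 - h n) / r n * lp_diam p (cball 0 1 :: (real ^ 'd) set)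
                        = 2 * (1 - h n) * real CARD('d) powr (1 / real_of_ereal p - 1 / 2) / r n) \<and>
             (2 \<le> p \<longrightarrow> (1 - h n) / r n * lp_diam p (cball 0 1 :: (real ^ 'd) set)
                        = 2 * (1 - h n) / r n))"
proof (intro conjI allI impI)
  define d where "d = real CARD('d)"
  define c where "c = 1 / 2 * (2 / d) powr ((d - 1) / 2) / measure lborel (cball 0 1 :: (real ^ 'd) set)"
  have "c > 0" by (simp add: c_def d_def content_cball_pos)
  have "filterlim (\<lambda>n. c * (h n powr ((d + 1) / 2) * real n)) at_top sequentially"
    using \<open>c > 0\<close> assms(5) unfolding d_def
    by (intro filterlim_tendsto_pos_mult_at_top[OF tendsto_const])
  then have "(\<lambda>n. exp (- (c * (h n powr ((d + 1) / 2) * real n)))) \<longlonglongrightarrow> 0"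
    by (intro filterlim_compose[OF exp_at_bot] filterlim_compose[OF filterlim_uminus_at_bot_at_top])
  then have lim: "(\<lambda>n. 1 - 2 * exp (- c * (h n powr ((d + 1) / 2) * real n))) \<longlonglongrightarrow> 1"
    using tendsto_diff[OF tendsto_const tendsto_mult[OF tendsto_const], of _ 0 sequentially 1 "2 :: real"] by simp
  show "almost_always (\<lambda>n. ball_points n :: (nat \<Rightarrow> real ^ 'd) measure)
           (\<lambda>n X. ereal_of_enat (rgg_diam p (r n) n X)
                    \<ge> ereal ((1 - h n) / r n * lp_diam p (cball 0 1 :: (real ^ 'd) set)))"
    unfolding almost_always_def
  proof (rule tendsto_sandwich[OF _ _ lim tendsto_const])
    show "\<forall>\<^sub>F n in sequentially. 1 - 2 * exp (- c * (h n powr ((d + 1) / 2) * real n)) \<le>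
       measure (ball_points n) {X \<in> space (ball_points n :: (nat \<Rightarrow> real ^ 'd) measure).
         ereal ((1 - h n) / r n * lp_diam p (cball 0 1 :: (real ^ 'd) set)) \<le> ereal_of_enat (rgg_diam p (r n) n X)}"
      using eventually_ge_at_top[of 1] unfolding c_def d_def
      by eventually_elim (intro prob_rgg_diam_ge assms)
    show "\<forall>\<^sub>F n in sequentially. measure (ball_points n) {X \<in> space (ball_points n :: (nat \<Rightarrow> real ^ 'd) measure).
         ereal ((1 - h n) / r n * lp_diam p (cball 0 1 :: (real ^ 'd) set)) \<le> ereal_of_enat (rgg_diam p (r n) n X)} \<le> 1"
      unfolding ball_points_def
      by (intro always_eventually allI prob_space.prob_le_1 prob_space_PiM ball_prob_space)
  qed
next
  fix n assume "p \<le> 2"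
  then show "(1 - h n) / r n * lp_diam p (cball 0 1 :: (real ^ 'd) set)
                        = 2 * (1 - h n) * real CARD('d) powr (1 / real_of_ereal p - 1 / 2) / r n"
    by (simp add: lp_diam_unit_ball[OF assms(1)] lp_radius_def)
next
  fix n assume "2 \<le> p"
  then have "lp_radius CARD('d) p = 1"
    by (cases "p = 2") (auto simp: lp_radius_def)
  then show "(1 - h n) / r n * lp_diam p (cball 0 1 :: (real ^ 'd) set) = 2 * (1 - h n) / r n"
    by (simp add: lp_diam_unit_ball[OF assms(1)])
qed

end
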